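(* Let $q$ be an odd prime power. Let $B=\bigcup_{i \in \mathbb{F}_q\cup\{\infty\}} \ell(i,b_i)$ with $b_i\in\mathbb{F}_q$, and for $P\in\mathbb{F}_q^2$ let $m_P$ be the number of indices $i\in\mathbb{F}_q\cup\{\infty\}$ with $P\in\ell(i,b_i)$. Suppose there is $j \in \mathbb{F}_q \cup \{\infty\}$ such that every point $P \in B$ with $m_P \geq 3$ lies on the line $\ell(j,b_j)$. Then \[ \sum_{P \in B} \frac{(m_P-1)(m_P-2)}{2} \geq \frac{q-1}{2}. \] Moreover, equality holds if and only if there are exactly $(q-1)/2$ points $P \in B$ with $m_P=3$ and no points $P\in B$ with $m_P > 3$.
   Context: $\mathbb{F}_q$ is the finite field with $q$ elements. For $m,b\in\mathbb{F}_q$, $\ell(m,b)$ denotes the line $\{(x,y)\in\mathbb{F}_q^2 : y=mx+b\}$, and for $a\in\mathbb{F}_q$, $\ell(\infty,a)$ denotes the vertical line $\{(x,y): x=a\}$. *)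

theory Defs
  imports Complex_Main "HOL-Library.Cardinality"
begin

text \<open>
  A slope in \<open>F\<^sub>q \<union> {\<infinity>}\<close> is a value of type \<open>'a option\<close>, where \<open>'a\<close> is the field \<open>F\<^sub>q\<close>
  and \<open>None\<close> stands for \<open>\<infinity>\<close>.
\<close>

fun line :: "'a::field option \<Rightarrow> 'a \<Rightarrow> ('a \<times> 'a) set" where
  "line (Some m) b = {(x, y). y = m * x + b}"
| "line None a = {(x, y). x = a}"

definition line_union :: "('a::field option \<Rightarrow> 'a) \<Rightarrow> ('a \<times> 'a) set" where
  "line_union b = (\<Union>i. line i (b i))"

definition multiplicity_at :: "('a::field option \<Rightarrow> 'a) \<Rightarrow> 'a \<times> 'a \<Rightarrow> nat" where
  "multiplicity_at b P = card {i. P \<in> line i (b i)}"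

end

theory Submission
  imports Defs
begin

text \<open>
  All multiplicities off the line \<open>\<ell>\<^sub>j\<close> are at most 2, so only the points of \<open>\<ell>\<^sub>j\<close> contribute
  to the sum. Writing \<open>n = m - 1\<close> on \<open>\<ell>\<^sub>j\<close>, the values \<open>n\<close> add up to \<open>q\<close>, and
  \<open>n (n - 1) \<ge> n\<close> unless \<open>n = 1\<close>; hence twice the sum is at least \<open>q - t\<close>, where \<open>t\<close> is the
  number of points of \<open>\<ell>\<^sub>j\<close> with \<open>m = 2\<close>.

  To see that \<open>t \<le> 1\<close>, suppose that there are two such points. The second lines \<open>u\<close> and \<open>v\<close>
  through them then contain no point of multiplicity greater than 2. In affine coordinates
  along \<open>u\<close> and \<open>v\<close>, each of the remaining \<open>q - 1\<close> lines has two intercepts; the first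
  intercepts, the second intercepts, and the ratios of the two (the slopes) each run exactly once
  through the nonzero field elements. So the product of the nonzero elements is its own quotient,
  that is, 1. But it is \<open>-1\<close>, a contradiction in odd characteristic (the argument of
  Bichara and Korchmaros on nuclei of sets of \<open>q + 2\<close> points).
\<close>

subsection \<open>The product of the nonzero elements of a finite field\<close>

text \<open>The orbits \<open>{x, h x}\<close> split \<open>S\<close> into pairs whose factors
  cancel; the induction removes one pair at a time.\<close>

lemma prod_fixpoint_free_involution:
  fixes f :: "'b \<Rightarrow> 'c::comm_monoid_mult"
  assumes "finite S"
    and "\<And>x. x \<in> S \<Longrightarrow> h x \<in> S" "\<And>x. x \<in> S \<Longrightarrow> h (h x) = x" "\<And>x. x \<in> S \<Longrightarrow> h x \<noteq> x"
    and "\<And>x. x \<in> S \<Longrightarrow> f x * f (h x) = 1"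
  shows "prod f S = 1"
  using assms
proof (induction "card S" arbitrary: S rule: less_induct)
  case less
  show ?case
  proof (cases "S = {}")
    case False
    then obtain x where x: "x \<in> S" by blast
    let ?S = "S - {x, h x}"
    have sub: "?S \<subset> S" using x by blast
    have stable: "h y \<in> ?S" if "y \<in> ?S" for y
      using that less.prems(2,3) x by (metis DiffD1 DiffD2 DiffI insert_iff singletonD)
    have "prod f ?S = 1"
      using less.prems stable by (intro less.hyps psubset_card_mono sub) auto
    moreover have "prod f S = prod f ?S * prod f {x, h x}"
      using less.prems(1,2) x by (intro prod.subset_diff) auto
    moreover have "prod f {x, h x} = 1"
      using less.prems(4)[OF x] less.prems(5)[OF x] by auto
    ultimately show ?thesis by simp
  qed simp
qed

lemma one_neq_minus_one_if_odd_card: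
  assumes "odd CARD('a::{field,finite})"
  shows "(1::'a) \<noteq> - 1"
proof
  assume "(1::'a) = - 1"
  then have two: "(1::'a) + 1 = 0" by (metis add.right_inverse)
  \<comment> \<open>The integer product is \<open>(- 1) ^ CARD('a)\<close> and so records the parity
    of the field size; if 1 = -1, then adding 1 is an involution without fixed points.\<close>
  have "prod (\<lambda>_::'a. - 1 :: int) UNIV = 1"
  proof (rule prod_fixpoint_free_involution[where h = "\<lambda>x. x + 1"])
    show "x + 1 + 1 = x" for x :: 'a by (simp only: add.assoc two add_0_right)
  qed auto
  with assms show False by simp
qed

text \<open>Wilson's theorem for finite fields: inversion pairs off all nonzero elements except 1
  and -1, which differ in odd characteristic.\<close>

lemma prod_nonzero_eq_minus_one:
  assumes "odd CARD('a::{field,finite})"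
  shows "\<Prod>(UNIV - {0::'a}) = - 1"
proof -
  have ne: "(1::'a) \<noteq> - 1" by (rule one_neq_minus_one_if_odd_card[OF assms])
  let ?S = "UNIV - {0, 1, - 1 :: 'a}"
  have "prod (\<lambda>x. x) ?S = 1"
  proof (rule prod_fixpoint_free_involution[where h = inverse])
    show "inverse x \<in> ?S" if "x \<in> ?S" for x :: 'a
      using that by (auto simp: inverse_eq_iff_eq[of x "- 1", simplified])
    show "inverse x \<noteq> x" if "x \<in> ?S" for x :: 'a
    proof
      assume "inverse x = x"
      then have "x * x = 1" using that by (metis DiffD2 insertCI right_inverse)
      with that show False by (simp add: square_eq_1_iff)
    qed
  qed auto
  moreover have "prod (\<lambda>x. x) (UNIV - {0::'a})
      = prod (\<lambda>x. x) ((UNIV - {0}) - {1, - 1}) * prod (\<lambda>x. x) {1, - 1}"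
    by (intro prod.subset_diff) auto
  moreover have "(UNIV - {0}) - {1, - 1} = ?S" by auto
  ultimately show ?thesis using ne by simp
qed

lemma prod_eq_prod_nonzero:
  fixes f :: "'b \<Rightarrow> 'a::{field,finite}"
  assumes "finite A" "card A = CARD('a) - 1" "inj_on f A" "\<And>x. x \<in> A \<Longrightarrow> f x \<noteq> 0"
  shows "prod f A = \<Prod>(UNIV - {0})"
proof -
  have "f ` A = UNIV - {0}"
  proof (rule card_subset_eq)
    show "card (f ` A) = card (UNIV - {0 :: 'a})"
      using assms(2,3) by (simp add: card_image card_Diff_subset)
  qed (use assms(4) in auto)
  then show ?thesis
    using prod.reindex[OF assms(3), of "\<lambda>x. x"] by simp
qed

subsection \<open>Lines through intersection points\<close>

fun line_dir :: "'a::field option \<Rightarrow> 'a \<times> 'a" where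
  "line_dir (Some m) = (1, m)"
| "line_dir None = (0, 1)"

text \<open>The 2 by 2 determinant of the direction vectors, which treats vertical lines like all
  others.\<close>

definition dir_det :: "'a::field option \<Rightarrow> 'a option \<Rightarrow> 'a" where
  "dir_det i k = fst (line_dir i) * snd (line_dir k) - snd (line_dir i) * fst (line_dir k)"

text \<open>An affine form vanishing exactly on the line, with signs chosen so that
  \<open>line_form_shift_along\<close> is uniform in both cases.\<close>

fun line_form :: "'a::field option \<Rightarrow> 'a \<Rightarrow> 'a \<times> 'a \<Rightarrow> 'a" where
  "line_form (Some m) c (x, y) = m * x + c - y"
| "line_form None a (x, y) = x - a"

definition shift_along :: "'a::field option \<Rightarrow> 'a \<Rightarrow> 'a \<times> 'a \<Rightarrow> 'a \<times> 'a" where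
  "shift_along u s P = (fst P + s * fst (line_dir u), snd P + s * snd (line_dir u))"

lemma mem_line_iff: "P \<in> line i c \<longleftrightarrow> line_form i c P = 0"
  by (cases i; cases P) auto

lemma dir_det_eq_0_iff: "dir_det i k = 0 \<longleftrightarrow> i = k"
  by (cases i; cases k) (auto simp: dir_det_def)

lemma line_form_shift_along:
  "line_form i c (shift_along u s P) = line_form i c P - s * dir_det i u"
  by (cases i; cases u; cases P) (auto simp: dir_det_def shift_along_def algebra_simps)

text \<open>The three-term Pluecker relation; for \<open>u \<noteq> v\<close> it makes
  \<open>dir_det k v / dir_det k u\<close> injective in \<open>k\<close>.\<close>

lemma dir_det_pluecker:
  "dir_det k v * dir_det k' u - dir_det k' v * dir_det k u = dir_det k k' * dir_det v u"
  by (simp add: dir_det_def algebra_simps)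

lemma lines_meet_once:
  assumes "i \<noteq> k"
  shows "\<exists>!P. P \<in> line i c \<and> P \<in> line k d"
proof (cases i)
  case None
  with assms show ?thesis by (cases k) auto
next
  case i: (Some m)
  show ?thesis
  proof (cases k)
    case (Some m')
    with i assms have "m - m' \<noteq> 0" by simp
    then have "m * x + c = m' * x + d \<longleftrightarrow> x = (d - c) / (m - m')" for x
      by (simp add: field_simps)
    then show ?thesis using i Some
      by (auto intro!: ex1I[of _ "((d - c) / (m - m'), m * ((d - c) / (m - m')) + c)"])
  qed (use i in auto)
qed

lemma multiplicity_ge_3:
  fixes b :: "'a::{field,finite} option \<Rightarrow> 'a"
  assumes "P \<in> line u (b u)" "P \<in> line k (b k)" "P \<in> line k' (b k')"
    and "u \<noteq> k" "u \<noteq> k'" "k \<noteq> k'"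
  shows "multiplicity_at b P \<ge> 3"
proof -
  have "card {u, k, k'} \<le> card {i. P \<in> line i (b i)}"
    using assms by (intro card_mono) auto
  then show ?thesis using assms(4-6) by (simp add: multiplicity_at_def)
qed

text \<open>By \<open>line_form_shift_along\<close>, each factor is the parameter, measured from
  \<open>Z\<close> along \<open>u\<close>, of the point where line \<open>k\<close> meets line
  \<open>u\<close>. A zero value or a repeated value would put three lines through one point of
  \<open>u\<close>, so the q - 1 values exhaust the nonzero elements.\<close>

lemma prod_intercepts:
  fixes b :: "'a::{field,finite} option \<Rightarrow> 'a"
  assumes "u \<noteq> v"
    and Z: "Z \<in> line u (b u)" "Z \<in> line v (b v)"
    and le2: "\<And>P. P \<in> line u (b u) \<Longrightarrow> multiplicity_at b P \<le> 2"
  shows "(\<Prod>k\<in>UNIV - {u, v}. line_form k (b k) Z / dir_det k u) = \<Prod>(UNIV - {0})"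
proof (rule prod_eq_prod_nonzero)
  let ?s = "\<lambda>k. line_form k (b k) Z / dir_det k u"
  show "card (UNIV - {u, v}) = CARD('a) - 1"
    using assms(1) by (simp add: card_Diff_subset card_UNIV_option)
  show "?s k \<noteq> 0" if "k \<in> UNIV - {u, v}" for k
  proof
    assume "?s k = 0"
    then have "Z \<in> line k (b k)" using that by (auto simp: mem_line_iff dir_det_eq_0_iff)
    then have "multiplicity_at b Z \<ge> 3"
      using that assms by (intro multiplicity_ge_3[of _ u b v k]) auto
    with le2[OF Z(1)] show False by simp
  qed
  have on_line: "shift_along u (?s k) Z \<in> line k (b k)" if "k \<noteq> u" for k
    using that by (simp add: mem_line_iff line_form_shift_along dir_det_eq_0_iff)
  have on_u: "shift_along u s Z \<in> line u (b u)" for s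
    using Z(1) dir_det_eq_0_iff[of u u] by (simp add: mem_line_iff line_form_shift_along)
  show "inj_on ?s (UNIV - {u, v})"
  proof (rule inj_onI, rule ccontr)
    fix k k' assume *: "k \<in> UNIV - {u, v}" "k' \<in> UNIV - {u, v}" "?s k = ?s k'" "k \<noteq> k'"
    then have "multiplicity_at b (shift_along u (?s k) Z) \<ge> 3"
      using on_line[of k] on_line[of k'] on_u by (intro multiplicity_ge_3[of _ u b k k']) auto
    with le2[OF on_u] show False by (metis Suc_n_not_le_n le_trans numeral_2_eq_2 numeral_3_eq_3)
  qed
qed simp

lemma no_two_lines_of_double_points:
  fixes b :: "'a::{field,finite} option \<Rightarrow> 'a"
  assumes "odd CARD('a)" "u \<noteq> v"
    and u: "\<And>P. P \<in> line u (b u) \<Longrightarrow> multiplicity_at b P \<le> 2"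
    and v: "\<And>P. P \<in> line v (b v) \<Longrightarrow> multiplicity_at b P \<le> 2"
  shows False
proof -
  obtain Z where Z: "Z \<in> line u (b u)" "Z \<in> line v (b v)"
    using lines_meet_once[OF assms(2)] by blast
  let ?A = "UNIV - {u, v}"
  let ?s = "\<lambda>k. line_form k (b k) Z / dir_det k u"
  let ?t = "\<lambda>k. line_form k (b k) Z / dir_det k v"
  \<comment> \<open>The ratio of the two intercepts: the numerators
    \<open>line_form k (b k) Z\<close> cancel, leaving a function of the slope alone.\<close>
  let ?r = "\<lambda>k. dir_det k v / dir_det k u"
  note W = prod_nonzero_eq_minus_one[OF assms(1)]
  have s: "prod ?s ?A = - 1"
    using prod_intercepts[OF assms(2) Z u] W by simp
  have t: "prod ?t ?A = - 1"
    using prod_intercepts[OF assms(2)[symmetric] Z(2,1) v] W by (simp add: insert_commute)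
  have "prod ?r ?A = - 1"
    unfolding W[symmetric]
  proof (rule prod_eq_prod_nonzero)
    show "card ?A = CARD('a) - 1"
      using assms(2) by (simp add: card_Diff_subset card_UNIV_option)
    show "inj_on ?r ?A"
    proof (rule inj_onI)
      fix k k' assume *: "k \<in> ?A" "k' \<in> ?A" "?r k = ?r k'"
      then have "dir_det k v * dir_det k' u - dir_det k' v * dir_det k u = 0"
        by (simp add: dir_det_eq_0_iff frac_eq_eq)
      with assms(2) show "k = k'"
        by (auto simp: dir_det_pluecker dir_det_eq_0_iff)
    qed
  qed (auto simp: dir_det_eq_0_iff)
  \<comment> \<open>All three products are -1, so this reads -1 = (-1)(-1).\<close>
  moreover have "prod ?s ?A = prod ?t ?A * prod ?r ?A"
    unfolding prod.distrib[symmetric] by (rule prod.cong) (auto simp: dir_det_eq_0_iff)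
  ultimately have "(1::'a) = - 1" using s t by simp
  with one_neq_minus_one_if_odd_card[OF assms(1)] show False by simp
qed

subsection \<open>Counting along the special line\<close>

lemma multiplicity_on_line:
  fixes b :: "'a::{field,finite} option \<Rightarrow> 'a"
  assumes "P \<in> line j (b j)"
  shows "multiplicity_at b P = Suc (card {i \<in> UNIV - {j}. P \<in> line i (b i)})"
proof -
  have "{i. P \<in> line i (b i)} = insert j {i \<in> UNIV - {j}. P \<in> line i (b i)}"
    using assms by auto
  then show ?thesis by (simp add: multiplicity_at_def)
qed

text \<open>Double counting of incidences: each of the q other lines meets line \<open>j\<close>
  exactly once, and the summand counts the other lines through \<open>P\<close>.\<close>

lemma sum_multiplicity_on_line:
  fixes b :: "'a::{field,finite} option \<Rightarrow> 'a"
  shows "(\<Sum>P\<in>line j (b j). real (multiplicity_at b P) - 1) = real CARD('a)"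
proof -
  have one: "card {P \<in> line j (b j). P \<in> line i (b i)} = 1" if "i \<noteq> j" for i
  proof -
    from that obtain P where "P \<in> line j (b j) \<and> P \<in> line i (b i)"
      and "\<forall>Q. Q \<in> line j (b j) \<and> Q \<in> line i (b i) \<longrightarrow> Q = P"
      by (metis lines_meet_once)
    then have "{P \<in> line j (b j). P \<in> line i (b i)} = {P}" by auto
    then show ?thesis by simp
  qed
  have "(\<Sum>P\<in>line j (b j). card {i \<in> UNIV - {j}. P \<in> line i (b i)}) = 1 * card (UNIV - {j})"
    using one by (intro sum_multicount) auto
  also have "\<dots> = CARD('a)" by (simp add: card_Diff_subset card_UNIV_option)
  finally have total: "(\<Sum>P\<in>line j (b j). card {i \<in> UNIV - {j}. P \<in> line i (b i)}) = CARD('a)" .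
  have "(\<Sum>P\<in>line j (b j). real (multiplicity_at b P) - 1)
      = (\<Sum>P\<in>line j (b j). real (card {i \<in> UNIV - {j}. P \<in> line i (b i)}))"
    by (rule sum.cong) (simp_all add: multiplicity_on_line[where j = j])
  also have "\<dots> = real CARD('a)"
    unfolding of_nat_sum[symmetric] total ..
  finally show ?thesis .
qed

lemma card_double_points_le_1:
  fixes b :: "'a::{field,finite} option \<Rightarrow> 'a"
  assumes "odd CARD('a)"
    and off: "\<And>P. multiplicity_at b P \<ge> 3 \<Longrightarrow> P \<in> line j (b j)"
  shows "card {P \<in> line j (b j). multiplicity_at b P = 2} \<le> 1"
proof -
  have ex: "\<exists>u. u \<noteq> j \<and> P \<in> line u (b u) \<and> (\<forall>Q\<in>line u (b u). multiplicity_at b Q \<le> 2)"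
    if P: "P \<in> line j (b j)" "multiplicity_at b P = 2" for P
  proof -
    have "card {i \<in> UNIV - {j}. P \<in> line i (b i)} = 1"
      using P multiplicity_on_line[of P j b] by simp
    then obtain u where "{i \<in> UNIV - {j}. P \<in> line i (b i)} = {u}"
      by (auto simp: card_1_singleton_iff)
    then have u: "u \<noteq> j" "P \<in> line u (b u)" by blast+
    \<comment> \<open>Otherwise \<open>off\<close> puts \<open>Q\<close> on line \<open>j\<close>,
      which line \<open>u\<close> meets only in the double point \<open>P\<close>.\<close>
    have "multiplicity_at b Q \<le> 2" if "Q \<in> line u (b u)" for Q
    proof (rule ccontr)
      assume *: "\<not> multiplicity_at b Q \<le> 2"
      then have "Q \<in> line j (b j)" by (intro off) simp
      then have "Q = P" using lines_meet_once[OF u(1)] u(2) P(1) that by blast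
      with * P show False by simp
    qed
    with u show ?thesis by blast
  qed
  have "P = Q" if P: "P \<in> line j (b j)" "multiplicity_at b P = 2"
    and Q: "Q \<in> line j (b j)" "multiplicity_at b Q = 2" for P Q
  proof -
    obtain u where u: "u \<noteq> j" "P \<in> line u (b u)" "\<forall>R\<in>line u (b u). multiplicity_at b R \<le> 2"
      using ex[OF P] by blast
    obtain v where v: "v \<noteq> j" "Q \<in> line v (b v)" "\<forall>R\<in>line v (b v). multiplicity_at b R \<le> 2"
      using ex[OF Q] by blast
    have "u = v" using no_two_lines_of_double_points[OF assms(1)] u(3) v(3) by blast
    then show "P = Q" using lines_meet_once[OF u(1)] u(2) v(2) P(1) Q(1) by blast
  qed
  then show ?thesis by (auto simp: card_le_Suc0_iff_eq)
qed

section \<open>The lower bound and the case of equality\<close>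

lemma excess_ge:
  fixes k :: nat
  assumes "k \<ge> 1"
  shows "(real k - 1) * (real k - 2) \<ge> (real k - 1) - (if k = 2 then 1 else 0)"
    and "k > 3 \<Longrightarrow> (real k - 1) * (real k - 2) > (real k - 1) - (if k = 2 then 1 else 0)"
proof -
  \<comment> \<open>The right-hand side is negative only for \<open>k = 2\<close>, where it is -1
    and the correction term makes up for it; it is positive for \<open>k > 3\<close>.\<close>
  have eq: "(real k - 1) * (real k - 2) - (real k - 1) = (real k - 1) * (real k - 3)"
    by (simp add: algebra_simps)
  show "k > 3 \<Longrightarrow> (real k - 1) * (real k - 2) > (real k - 1) - (if k = 2 then 1 else 0)"
    using eq mult_pos_pos[of "real k - 1" "real k - 3"] by simp
  consider "k = 1" | "k = 2" | "k \<ge> 3" using assms by linarith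
  then show "(real k - 1) * (real k - 2) \<ge> (real k - 1) - (if k = 2 then 1 else 0)"
    using eq mult_nonneg_nonneg[of "real k - 1" "real k - 3"] by cases auto
qed

theorem theorem2:
  fixes b :: "'a::{field,finite} option \<Rightarrow> 'a"
    and B :: "('a \<times> 'a) set"
    and m :: "'a \<times> 'a \<Rightarrow> nat"
    and q :: nat
  assumes "q = CARD('a)" and "odd q"
    and "B = line_union b"
    and "\<And>P. m P = multiplicity_at b P"
    and "\<exists>j. \<forall>P\<in>B. m P \<ge> 3 \<longrightarrow> P \<in> line j (b j)"
  shows "(\<Sum>P\<in>B. (real (m P) - 1) * (real (m P) - 2) / 2) \<ge> (real q - 1) / 2 \<and>
    ((\<Sum>P\<in>B. (real (m P) - 1) * (real (m P) - 2) / 2) = (real q - 1) / 2 \<longleftrightarrow>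
      real (card {P \<in> B. m P = 3}) = (real q - 1) / 2 \<and> \<not> (\<exists>P\<in>B. m P > 3))"
proof -
  let ?f = "\<lambda>P. (real (m P) - 1) * (real (m P) - 2)"
  let ?g = "\<lambda>P. (real (m P) - 1) - (if m P = 2 then 1 else 0)"
  let ?S = "\<Sum>P\<in>B. ?f P / 2"
  obtain j where j: "\<And>P. P \<in> B \<Longrightarrow> m P \<ge> 3 \<Longrightarrow> P \<in> line j (b j)"
    using assms(5) by blast
  let ?L = "line j (b j)"
  \<comment> \<open>This excludes \<open>m P = 0\<close>, at which the summand would be 1 rather
    than 0.\<close>
  have B: "P \<in> B \<longleftrightarrow> m P \<ge> 1" for P
  proof -
    have "P \<in> B \<longleftrightarrow> {i. P \<in> line i (b i)} \<noteq> {}"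
      using assms(3) by (auto simp: line_union_def)
    also have "\<dots> \<longleftrightarrow> m P \<ge> 1"
      by (simp only: assms(4) multiplicity_at_def One_nat_def Suc_le_eq card_gt_0_iff) simp
    finally show ?thesis .
  qed
  have LB: "?L \<subseteq> B" using assms(3) by (auto simp: line_union_def)
  have "(\<Sum>P\<in>B. ?f P) = (\<Sum>P\<in>?L. ?f P)"
  proof (rule sum.mono_neutral_right)
    show "\<forall>P\<in>B - ?L. ?f P = 0"
    proof
      fix P assume "P \<in> B - ?L"
      then have "m P = 1 \<or> m P = 2" using j[of P] B[of P] by force
      then show "?f P = 0" by auto
    qed
  qed (use LB in auto)
  then have S: "2 * ?S = (\<Sum>P\<in>?L. ?f P)" by (simp add: sum_divide_distrib[symmetric])
  have "card {P \<in> ?L. m P = 2} \<le> 1"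
    unfolding assms(4)
  proof (rule card_double_points_le_1)
    show "odd CARD('a)" using assms(1,2) by simp
    show "P \<in> ?L" if "multiplicity_at b P \<ge> 3" for P
      using that j[of P] B[of P] by (simp add: assms(4))
  qed
  moreover have "(\<Sum>P\<in>?L. ?g P) = real q - real (card {P \<in> ?L. m P = 2})"
  proof -
    have "(\<Sum>P\<in>?L. real (m P) - 1) = real q"
      using sum_multiplicity_on_line[where b = b and j = j] by (simp add: assms(1,4))
    moreover have "(\<Sum>P\<in>?L. if m P = 2 then 1 else 0 :: real) = real (card {P \<in> ?L. m P = 2})"
      by (simp add: sum.If_cases Int_def)
    ultimately show ?thesis by (simp add: sum_subtractf)
  qed
  ultimately have g: "real q - 1 \<le> (\<Sum>P\<in>?L. ?g P)" by simp
  have fg: "?g P \<le> ?f P" if "P \<in> ?L" for P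
    using excess_ge(1)[of "m P"] that LB B by blast
  then have "(\<Sum>P\<in>?L. ?g P) \<le> (\<Sum>P\<in>?L. ?f P)" by (rule sum_mono)
  with g S have ge: "?S \<ge> (real q - 1) / 2" by simp
  \<comment> \<open>A point with \<open>m P > 3\<close> lies on \<open>?L\<close> and makes the
    termwise comparison of \<open>?g\<close> with \<open>?f\<close> strict.\<close>
  have le3: "\<not> (\<exists>P\<in>B. m P > 3)" if "?S = (real q - 1) / 2"
  proof
    assume "\<exists>P\<in>B. m P > 3"
    then obtain P where P: "P \<in> B" "m P > 3" by blast
    then have "P \<in> ?L" using j by simp
    moreover have "?g P < ?f P" using P excess_ge(2)[of "m P"] B by blast
    ultimately have "(\<Sum>P\<in>?L. ?g P) < (\<Sum>P\<in>?L. ?f P)"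
      by (intro sum_strict_mono_ex1 ballI bexI[of _ P] fg) simp_all
    with g S that show False by simp
  qed
  \<comment> \<open>The summand is 0, 0, 1 for multiplicities 1, 2, 3, so the sum just counts triple
    points; this serves both directions of the equivalence.\<close>
  have S3: "?S = real (card {P \<in> B. m P = 3})" if "\<not> (\<exists>P\<in>B. m P > 3)"
  proof -
    have "?S = (\<Sum>P\<in>B. if m P = 3 then 1 else 0)"
    proof (rule sum.cong)
      fix P assume "P \<in> B"
      then have "m P = 1 \<or> m P = 2 \<or> m P = 3" using that B[of P] by force
      then show "?f P / 2 = (if m P = 3 then 1 else 0)" by auto
    qed simp
    also have "\<dots> = real (card {P \<in> B. m P = 3})" by (simp add: sum.If_cases Int_def)
    finally show ?thesis .
  qed
  show ?thesis
  proof (intro conjI iffI)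
    show "?S \<ge> (real q - 1) / 2" by (rule ge)
    assume eq: "?S = (real q - 1) / 2"
    show "\<not> (\<exists>P\<in>B. m P > 3)" by (rule le3[OF eq])
    show "real (card {P \<in> B. m P = 3}) = (real q - 1) / 2"
      using S3[OF le3[OF eq]] eq by (rule trans[OF sym])
  next
    assume *: "real (card {P \<in> B. m P = 3}) = (real q - 1) / 2 \<and> \<not> (\<exists>P\<in>B. m P > 3)"
    show "?S = (real q - 1) / 2"
      using S3[OF conjunct2[OF *]] conjunct1[OF *] by (rule trans)
  qed
qed

end
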